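(* There is no assignment, to each countable limit ordinal $\eta$ (i.e. each limit ordinal $\eta<\Omega$), of a strictly increasing sequence $(\eta_n)_{n<\omega}$ of ordinals with $\sup_{n<\omega}\eta_n=\eta$, such that the following holds: for every countable limit ordinal $\eta$, every $n<\omega$, and every limit ordinal $\beta$ with $\eta_n<\beta\leq\eta_{n+1}$, the first term $\beta_0$ of the sequence assigned to $\beta$ satisfies $\beta_0\geq\eta_n$.
   Context: $\Omega=\omega_1$ denotes the first uncountable ordinal. *)

theory Defs
  imports "HOL-Library.Countable_Set_Type" "HOL-Library.Lub_Glb"
begin

text \<open>
  \<open>cardSuc natLeq\<close> is a well-order of the least order type whose cardinality exceeds that of the
  natural numbers, i.e. of type \<open>\<Omega>\<close>. Its elements are identified with the ordinals below \<open>\<Omega>\<close>.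
\<close>

typedef omega1 = "Field (cardSuc natLeq)"
  using Field_cardSuc_not_empty[OF natLeq_Card_order] by auto

setup_lifting type_definition_omega1

lemma Well_order_cardSuc_natLeq: "Well_order (cardSuc natLeq)"
  using cardSuc_Card_order[OF natLeq_Card_order] card_order_on_well_order_on by blast

instantiation omega1 :: wellorder
begin

lift_definition less_eq_omega1 :: "omega1 \<Rightarrow> omega1 \<Rightarrow> bool"
  is "\<lambda>x y. (x, y) \<in> cardSuc natLeq" .

lift_definition less_omega1 :: "omega1 \<Rightarrow> omega1 \<Rightarrow> bool"
  is "\<lambda>x y. (x, y) \<in> cardSuc natLeq \<and> x \<noteq> y" .

instance
proof
  note wo = Well_order_cardSuc_natLeq
  have refl: "x \<in> Field (cardSuc natLeq) \<Longrightarrow> (x, x) \<in> cardSuc natLeq" for x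
    using wo by (auto simp: order_on_defs refl_on_def)
  have trans: "trans (cardSuc natLeq)" and anti: "antisym (cardSuc natLeq)"
    and tot: "Total (cardSuc natLeq)" and wf: "wf (cardSuc natLeq - Id)"
    using wo by (auto simp: order_on_defs)
  fix x y z :: omega1
  show "(x < y) = (x \<le> y \<and> \<not> y \<le> x)"
    unfolding less_omega1.rep_eq less_eq_omega1.rep_eq
    using antisymD[OF anti] refl[OF Rep_omega1] by metis
  show "x \<le> x"
    unfolding less_eq_omega1.rep_eq by (rule refl[OF Rep_omega1])
  show "x \<le> y \<Longrightarrow> y \<le> z \<Longrightarrow> x \<le> z"
    unfolding less_eq_omega1.rep_eq by (rule transD[OF trans])
  show "x \<le> y \<Longrightarrow> y \<le> x \<Longrightarrow> x = y"
    unfolding less_eq_omega1.rep_eq using antisymD[OF anti] Rep_omega1_inject by blast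
  show "x \<le> y \<or> y \<le> x"
    unfolding less_eq_omega1.rep_eq
    using tot refl[OF Rep_omega1] Rep_omega1 unfolding total_on_def by metis
  fix P :: "omega1 \<Rightarrow> bool" and a :: omega1
  assume step: "\<And>x. (\<And>y. y < x \<Longrightarrow> P y) \<Longrightarrow> P x"
  have "wf (inv_image (cardSuc natLeq - Id) Rep_omega1)"
    using wf by (rule wf_inv_image)
  moreover have "inv_image (cardSuc natLeq - Id) Rep_omega1 = {(x, y). x < y}"
    by (auto simp: less_omega1.rep_eq Rep_omega1_inject)
  ultimately have "wf {(x :: omega1, y). x < y}" by simp
  then show "P a"
    by (induction a rule: wf_induct_rule) (use step in auto)
qed

end

text \<open>
  These two facts determine the well-order up to isomorphism: an uncountable well-order all of whose
  proper initial segments are countable has order type \<open>\<Omega>\<close>.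
\<close>

lemma uncountable_UNIV_omega1:
  includes cardinal_syntax
  shows "uncountable (UNIV :: omega1 set)"
proof
  assume "countable (UNIV :: omega1 set)"
  then have "countable (range Rep_omega1)" by simp
  then have "countable (Field (cardSuc natLeq))"
    by (simp add: type_definition.Rep_range[OF type_definition_omega1])
  then have "|Field (cardSuc natLeq)| \<le>o natLeq"
    by (simp add: countable_card_le_natLeq)
  then have "cardSuc natLeq \<le>o natLeq"
    using card_of_Field_ordIso[OF cardSuc_Card_order[OF natLeq_Card_order]]
      ordIso_ordLeq_trans ordIso_symmetric by blast
  then show False
    using cardSuc_greater[OF natLeq_Card_order] not_ordLess_ordLeq by blast
qed

lemma countable_lessThan_omega1:
  includes cardinal_syntax
  shows "countable {..<\<eta> :: omega1}"
proof -
  have "|underS (cardSuc natLeq) (Rep_omega1 \<eta>)| <o cardSuc natLeq"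
    using card_of_underS[OF cardSuc_Card_order[OF natLeq_Card_order] Rep_omega1] .
  then have "|underS (cardSuc natLeq) (Rep_omega1 \<eta>)| \<le>o natLeq"
    using cardSuc_ordLeq_ordLess[OF natLeq_Card_order card_of_Card_order] by blast
  then have "countable (underS (cardSuc natLeq) (Rep_omega1 \<eta>))"
    by (simp add: countable_card_le_natLeq)
  moreover have "Rep_omega1 ` {..<\<eta>} \<subseteq> underS (cardSuc natLeq) (Rep_omega1 \<eta>)"
    by (auto simp: underS_def less_omega1.rep_eq)
  ultimately have "countable (Rep_omega1 ` {..<\<eta>})"
    by (rule countable_subset[rotated])
  then show ?thesis
    by (rule countable_image_inj_on) (simp add: inj_on_def Rep_omega1_inject)
qed

definition ord_zero :: omega1
  where "ord_zero = (LEAST \<xi>. True)"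

definition ord_succ :: "omega1 \<Rightarrow> omega1"
  where "ord_succ \<xi> = (LEAST \<zeta>. \<xi> < \<zeta>)"

definition limit_ordinal :: "omega1 \<Rightarrow> bool"
  where "limit_ordinal \<eta> \<longleftrightarrow> \<eta> \<noteq> ord_zero \<and> (\<nexists>\<xi>. \<eta> = ord_succ \<xi>)"

lemma ord_zero_le: "ord_zero \<le> \<xi>"
  unfolding ord_zero_def by (simp add: Least_le)

lemma less_ord_succ: "\<xi> < ord_succ \<xi>"
proof -
  have "{..\<xi>} = insert \<xi> {..<\<xi>}" by auto
  then have "countable {..\<xi>}"
    using countable_lessThan_omega1[of \<xi>] by simp
  then have "{..\<xi>} \<noteq> UNIV"
    using uncountable_UNIV_omega1 by metis
  then have "\<exists>\<zeta>. \<xi> < \<zeta>"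
    by (auto simp: not_le)
  then show ?thesis
    unfolding ord_succ_def by (rule LeastI_ex)
qed

lemma ord_succ_le_iff: "ord_succ \<xi> \<le> \<zeta> \<longleftrightarrow> \<xi> < \<zeta>"
  using less_ord_succ[of \<xi>] unfolding ord_succ_def by (auto intro: Least_le)

end

theory Submission
  imports Defs
begin

text \<open>
  Write \<open>\<beta>\<^sub>0\<close> for the first term at \<open>\<beta>\<close>. Coherence forces the set of \<open>\<beta>\<close> with \<open>\<beta>\<^sub>0 = \<gamma>\<close> to be bounded,
  for every \<open>\<gamma>\<close>: otherwise some limit \<open>\<eta> > \<gamma>\<close> is a limit of such \<open>\<beta>\<close>, one of which lies in an interval
  \<open>(\<eta>\<^sub>m, \<eta>\<^sub>m\<^sub>+\<^sub>1]\<close> with \<open>\<gamma> < \<eta>\<^sub>m\<close>, contradicting \<open>\<eta>\<^sub>m \<le> \<beta>\<^sub>0\<close>. But \<open>\<beta> \<mapsto> \<beta>\<^sub>0\<close> is regressive, so not all its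
  fibres can be bounded, as one sees at a limit \<open>\<eta>\<close> closed under the map bounding the fibres.
\<close>

text \<open>The initial segments \<open>{..a}\<close> are countable, so countably many of them
  cannot exhaust the uncountable \<open>omega1\<close>; any point they miss is a strict
  bound.\<close>

lemma countable_bounded_omega1:
  fixes A :: "omega1 set"
  assumes "countable A"
  obtains b where "\<And>a. a \<in> A \<Longrightarrow> a < b"
proof -
  have "countable {..a :: omega1}" for a
    using countable_lessThan_omega1[of "ord_succ a"]
    by (rule countable_subset[rotated]) (auto intro: le_less_trans less_ord_succ)
  then have "countable (\<Union>a\<in>A. {..a})"
    using assms by blast
  then have "(\<Union>a\<in>A. {..a}) \<noteq> UNIV"
    using uncountable_UNIV_omega1 by metis
  then obtain b where "b \<notin> (\<Union>a\<in>A. {..a})"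
    by blast
  then show thesis
    by (intro that[of b]) (auto simp: not_le)
qed

text \<open>The least strict upper bound of the range works: it exists because the range is
  countable, and a predecessor \<xi> of it would lie below some \<open>f n\<close>, leaving no room
  for \<open>f n\<close> under the bound.\<close>

lemma strict_mono_omega1_limit:
  fixes f :: "nat \<Rightarrow> omega1"
  assumes "strict_mono f"
  obtains \<eta> where "limit_ordinal \<eta>" "\<And>n. f n < \<eta>" "\<And>x. x < \<eta> \<Longrightarrow> \<exists>n. x < f n"
proof -
  obtain b where "\<And>a. a \<in> range f \<Longrightarrow> a < b"
    using countable_bounded_omega1[of "range f"] by auto
  then have ex: "\<exists>b. \<forall>n. f n < b"
    by blast
  define \<eta> where "\<eta> = (LEAST b. \<forall>n. f n < b)"
  have upper: "f n < \<eta>" for n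
    using LeastI_ex[OF ex] unfolding \<eta>_def by blast
  have cofinal: "\<exists>n. x < f n" if "x < \<eta>" for x
  proof -
    have "\<not> (\<forall>n. f n < x)"
      using that not_less_Least unfolding \<eta>_def by blast
    then obtain n where "x \<le> f n"
      by (auto simp: not_less)
    also have "f n < f (Suc n)"
      using assms by (simp add: strict_mono_Suc_iff)
    finally show ?thesis ..
  qed
  have "\<eta> \<noteq> ord_zero"
    using upper[of 0] ord_zero_le[of "f 0"] by auto
  moreover have "\<eta> \<noteq> ord_succ \<xi>" for \<xi>
  proof
    assume \<eta>: "\<eta> = ord_succ \<xi>"
    then obtain n where "\<xi> < f n"
      using cofinal[of \<xi>] less_ord_succ by blast
    then have "\<eta> \<le> f n"
      using \<eta> ord_succ_le_iff by simp
    then show False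
      using upper[of n] by simp
  qed
  ultimately have "limit_ordinal \<eta>"
    unfolding limit_ordinal_def by blast
  then show thesis
    using that upper cofinal by blast
qed

text \<open>Iterate \<open>P\<close> \<omega> times, starting above \<open>a\<close>, and take the
  supremum. This serves twice: to close off under a function bounding fibres, and to reach a limit
  of members of an unbounded fibre.\<close>

lemma limit_ordinal_closed_under:
  fixes P :: "omega1 \<Rightarrow> omega1 \<Rightarrow> bool"
  assumes "\<And>x. \<exists>y > x. P x y"
  obtains \<eta> where "limit_ordinal \<eta>" "a < \<eta>" "\<And>x. x < \<eta> \<Longrightarrow> \<exists>y z. x < y \<and> y < z \<and> z < \<eta> \<and> P y z"
proof -
  have "\<exists>f. \<forall>n. a < f n \<and> f n < f (Suc n) \<and> P (f n) (f (Suc n))"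
  \<comment> \<open>The invariant \<open>a < x\<close> is carried along only to place
    \<open>f 0\<close> above \<open>a\<close>.\<close>
  proof (rule dependent_nat_choice[where P = "\<lambda>_ x. a < x" and Q = "\<lambda>_ x y. x < y \<and> P x y",
        folded all_conj_distrib])
    show "\<exists>x. a < x"
      using less_ord_succ by blast
    show "\<exists>y>a. x < y \<and> P x y" if "a < x" for x and n :: nat
      using assms[of x] that less_trans by blast
  qed
  then obtain f where f: "a < f 0" "\<And>n. f n < f (Suc n)" "\<And>n. P (f n) (f (Suc n))"
    by blast
  then have "strict_mono f"
    by (simp add: strict_mono_Suc_iff)
  then obtain \<eta> where \<eta>: "limit_ordinal \<eta>" "\<And>n. f n < \<eta>" "\<And>x. x < \<eta> \<Longrightarrow> \<exists>n. x < f n"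
    using strict_mono_omega1_limit by blast
  show thesis
  proof (rule that[OF \<eta>(1)])
    show "a < \<eta>"
      using f(1) \<eta>(2) less_trans by blast
    show "\<exists>y z. x < y \<and> y < z \<and> z < \<eta> \<and> P y z" if "x < \<eta>" for x
      using \<eta>(3)[OF that] \<eta>(2) f(2,3) by blast
  qed
qed

text \<open>A weak form of Fodor's pressing-down lemma, with an unbounded fibre in place of a
  stationary one.\<close>

lemma regressive_unbounded_fibre:
  fixes h :: "omega1 \<Rightarrow> omega1"
  assumes "\<And>\<beta>. limit_ordinal \<beta> \<Longrightarrow> h \<beta> < \<beta>"
  shows "\<exists>\<gamma>. \<forall>x. \<exists>\<beta> > x. limit_ordinal \<beta> \<and> h \<beta> = \<gamma>"
proof (rule ccontr)
  assume "\<not> ?thesis"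
  then have "\<forall>\<gamma>. \<exists>b. \<forall>\<beta>. limit_ordinal \<beta> \<longrightarrow> h \<beta> = \<gamma> \<longrightarrow> \<beta> \<le> b"
    by (meson not_le)
  then obtain b where b: "\<And>\<beta>. limit_ordinal \<beta> \<Longrightarrow> \<beta> \<le> b (h \<beta>)"
    by metis
  \<comment> \<open>Only countably many fibres have index below \<open>x\<close>, so their bounds
    have a common strict bound.\<close>
  have "\<exists>y > x. \<forall>\<gamma> < x. b \<gamma> < y" for x
  proof -
    have "countable (insert x (b ` {..<x}))"
      using countable_lessThan_omega1 by simp
    then show ?thesis
      by (rule countable_bounded_omega1) auto
  qed
  then obtain \<eta> where \<eta>: "limit_ordinal \<eta>"
    "\<And>x. x < \<eta> \<Longrightarrow> \<exists>y z. x < y \<and> y < z \<and> z < \<eta> \<and> (\<forall>\<gamma> < y. b \<gamma> < z)"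
    by (rule limit_ordinal_closed_under[where a = ord_zero]) blast
  \<comment> \<open>Since \<open>h \<eta> < \<eta>\<close>, closure at \<open>x = h \<eta>\<close>
    gives \<open>h \<eta> < y\<close> and hence \<open>b (h \<eta>) < z < \<eta>\<close>.\<close>
  then have "b (h \<eta>) < \<eta>"
    using assms less_trans by meson
  with b[OF \<eta>(1)] show False
    by simp
qed

lemma isLub_strict_mono_less:
  fixes f :: "nat \<Rightarrow> 'a :: linorder"
  assumes "strict_mono f" "isLub UNIV (range f) a"
  shows "f n < a" and "x < a \<Longrightarrow> \<exists>n. x < f n"
proof -
  have "f n < f (Suc n)"
    using assms(1) by (simp add: strict_mono_Suc_iff)
  also have "f (Suc n) \<le> a"
    using isLubD2[OF assms(2)] by simp
  finally show "f n < a" .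
  show "\<exists>n. x < f n" if "x < a"
  proof (rule ccontr)
    assume "\<not> ?thesis"
    then have "isUb UNIV (range f) x"
      by (auto simp: isUb_def setle_def not_less)
    then have "a \<le> x"
      by (rule isLub_le_isUb[OF assms(2)])
    with that show False
      by simp
  qed
qed

text \<open>The first index at which \<open>f\<close> reaches \<open>x\<close> exceeds
  \<open>n\<close>, so it is a successor \<open>Suc m\<close> with \<open>n \<le> m\<close>.\<close>

lemma strict_mono_crossing:
  fixes f :: "nat \<Rightarrow> 'a :: linorder"
  assumes "strict_mono f" "f n < x" "x \<le> f k"
  obtains m where "n \<le> m" "f m < x" "x \<le> f (Suc m)"
proof -
  define k' where "k' = (LEAST k. x \<le> f k)"
  have k': "x \<le> f k'"
    unfolding k'_def using assms(3) by (rule LeastI)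
  have "f n < f k'"
    using assms(2) k' by simp
  then have "n < k'"
    using assms(1) by (simp add: strict_mono_less)
  then obtain m where m: "k' = Suc m" "n \<le> m"
    by (cases k') auto
  then have "\<not> x \<le> f m"
    using not_less_Least[of m "\<lambda>k. x \<le> f k"] unfolding k'_def[symmetric] by simp
  then show thesis
    using that m k' by (simp add: not_le)
qed

theorem mainTheorem7:
  shows "\<nexists>s :: omega1 \<Rightarrow> nat \<Rightarrow> omega1.
    (\<forall>\<eta>. limit_ordinal \<eta> \<longrightarrow> strict_mono (s \<eta>) \<and> isLub UNIV (range (s \<eta>)) \<eta>) \<and>
    (\<forall>\<eta> n \<beta>. limit_ordinal \<eta> \<longrightarrow> limit_ordinal \<beta> \<longrightarrow> s \<eta> n < \<beta> \<longrightarrow> \<beta> \<le> s \<eta> (Suc n) \<longrightarrow>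
      s \<eta> n \<le> s \<beta> 0)"
proof (rule notI, elim exE conjE)
  fix s :: "omega1 \<Rightarrow> nat \<Rightarrow> omega1"
  assume fundamental:
      "\<forall>\<eta>. limit_ordinal \<eta> \<longrightarrow> strict_mono (s \<eta>) \<and> isLub UNIV (range (s \<eta>)) \<eta>"
    and coherent: "\<forall>\<eta> n \<beta>. limit_ordinal \<eta> \<longrightarrow> limit_ordinal \<beta> \<longrightarrow> s \<eta> n < \<beta> \<longrightarrow>
      \<beta> \<le> s \<eta> (Suc n) \<longrightarrow> s \<eta> n \<le> s \<beta> 0"
  have mono: "strict_mono (s \<eta>)" and below: "s \<eta> n < \<eta>"
    and cofinal: "x < \<eta> \<Longrightarrow> \<exists>n. x < s \<eta> n" if "limit_ordinal \<eta>" for \<eta> n x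
    using fundamental that isLub_strict_mono_less[of "s \<eta>" \<eta>] by blast+
  obtain \<gamma> where "\<And>x. \<exists>\<beta> > x. limit_ordinal \<beta> \<and> s \<beta> 0 = \<gamma>"
    using regressive_unbounded_fibre[of "\<lambda>\<beta>. s \<beta> 0"] below by blast
  \<comment> \<open>Here the relation ignores its first argument and says that the second lies in
    the fibre over \<gamma>, so that fibre is cofinal in \<eta>.\<close>
  then obtain \<eta> where \<eta>: "limit_ordinal \<eta>" "\<gamma> < \<eta>"
    "\<And>x. x < \<eta> \<Longrightarrow> \<exists>y \<beta>. x < y \<and> y < \<beta> \<and> \<beta> < \<eta> \<and> limit_ordinal \<beta> \<and> s \<beta> 0 = \<gamma>"
    by (rule limit_ordinal_closed_under[where a = \<gamma>]) blast
  obtain n where n: "\<gamma> < s \<eta> n"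
    using cofinal \<eta>(1,2) by blast
  obtain \<beta> where \<beta>: "s \<eta> n < \<beta>" "\<beta> < \<eta>" "limit_ordinal \<beta>" "s \<beta> 0 = \<gamma>"
    using \<eta>(3)[OF below[OF \<eta>(1)]] less_trans by blast
  obtain k where "\<beta> < s \<eta> k"
    using cofinal[OF \<eta>(1) \<beta>(2)] by blast
  then obtain m where m: "n \<le> m" "s \<eta> m < \<beta>" "\<beta> \<le> s \<eta> (Suc m)"
    using strict_mono_crossing[OF mono[OF \<eta>(1)] \<beta>(1)] less_imp_le by blast
  \<comment> \<open>Coherence on the interval containing \<beta> bounds \<open>s \<eta> m\<close> by
    \<open>s \<beta> 0 = \<gamma>\<close>, although \<open>\<gamma> < s \<eta> n\<close> and
    \<open>n \<le> m\<close>.\<close>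
  have "s \<eta> m \<le> \<gamma>"
    using coherent \<eta>(1) \<beta>(3,4) m(2,3) by blast
  moreover have "s \<eta> n \<le> s \<eta> m"
    using mono[OF \<eta>(1)] m(1) by (simp add: strict_mono_less_eq)
  ultimately show False
    using n by simp
qed

end
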